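(* Let $n$ be a positive integer, let $E_n$ be the edgeless graph on $n$ vertices and $K_n$ the complete graph on $n$ vertices. Then $\mathrm{avi}(K_n)=\frac{n}{n+1}$ and $\mathrm{avi}(E_n)=\frac n2$, and for every $n$-vertex graph $G$ that is neither the edgeless graph $E_n$ nor the complete graph $K_n$, $$\frac{n}{n+1}=\mathrm{avi}(K_n)<\mathrm{avi}(G)<\mathrm{avi}(E_n)=\frac n2 .$$
   Context: All graphs are finite and simple. For a graph $G$, an independent set is a set of pairwise non-adjacent vertices (the empty set is independent). $\mathrm{avi}(G)$ denotes the average size of independent sets of $G$: $\mathrm{avi}(G)=\mathrm{T}(G)/\mathrm{I}(G)$, where $\mathrm{I}(G)$ is the number of independent sets of $G$ and $\mathrm{T}(G)$ is the sum of the cardinalities of all independent sets of $G$. *)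

theory Defs
  imports Complex_Main "Graph_Theory.Graph_Theory"
begin

text \<open>
  Finite simple graphs are the locale \<^term>\<open>graph\<close>: finite symmetric digraphs without loops or
  parallel arcs, an undirected edge being a pair of opposite arcs. The library renders
  ``\<open>G\<close> is (a copy of) the complete graph on \<open>n\<close> vertices'' as the predicate
  \<^term>\<open>complete_digraph n G\<close>, which is invariant under isomorphism; the edgeless graph is
  treated in the same way.
\<close>

definition edgeless_digraph :: "nat \<Rightarrow> ('a, 'b) pre_digraph \<Rightarrow> bool" where
  "edgeless_digraph n G \<longleftrightarrow> graph G \<and> card (verts G) = n \<and> arcs_ends G = {}"

definition independent_set :: "('a, 'b) pre_digraph \<Rightarrow> 'a set \<Rightarrow> bool" where
  "independent_set G S \<longleftrightarrow> S \<subseteq> verts G \<and> pairwise (\<lambda>u v. \<not> u \<rightarrow>\<^bsub>G\<^esub> v) S"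

definition num_indep :: "('a, 'b) pre_digraph \<Rightarrow> nat" where
  "num_indep G = card {S. independent_set G S}"

definition total_indep :: "('a, 'b) pre_digraph \<Rightarrow> nat" where
  "total_indep G = (\<Sum>S | independent_set G S. card S)"

definition avi :: "('a, 'b) pre_digraph \<Rightarrow> real" where
  "avi G = real (total_indep G) / real (num_indep G)"

lemma ex_complete_digraph: "\<exists>G :: (nat, nat \<times> nat) pre_digraph. complete_digraph n G"
proof
  show "complete_digraph n
    (with_proj \<lparr>pverts = {..<n}, parcs = {(u, v). (u, v) \<in> {..<n} \<times> {..<n} \<and> u \<noteq> v}\<rparr>)"
    by (simp add: complete_digraph_pair_def)
qed

lemma ex_edgeless_digraph: "\<exists>G :: (nat, nat \<times> nat) pre_digraph. edgeless_digraph n G"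
proof
  interpret pair_graph "\<lparr>pverts = {..<n}, parcs = {}\<rparr>"
    by unfold_locales (auto simp: symmetric_def sym_def)
  show "edgeless_digraph n (with_proj \<lparr>pverts = {..<n}, parcs = {}\<rparr>)"
    unfolding edgeless_digraph_def using graph_axioms by simp
qed

end

theory Submission
  imports Defs
begin

text \<open>
  The independent sets form a down-closed family containing all singletons. The lower bound compares
  the sets of size at least two, each of size more than the average, with the empty set and the
  singletons, which are all that \<open>K\<^sub>n\<close> has. For the upper bound, \<open>S \<mapsto> S - {v}\<close> injects the independent
  sets containing \<open>v\<close> into those avoiding \<open>v\<close>, so every vertex lies in at most half of the independent
  sets; at an endpoint \<open>v\<close> of an edge \<open>uv\<close> this is strict, because \<open>{u}\<close> is not in the image.
\<close>

text \<open>Complementation is an involution of \<open>Pow V\<close>, and the sizes of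
  \<open>S\<close> and \<open>V - S\<close> add up to \<open>card V\<close>.\<close>

lemma double_sum_card_Pow:
  assumes "finite V"
  shows "2 * (\<Sum>S\<in>Pow V. card S) = card V * card (Pow V)"
proof -
  have "(\<Sum>S\<in>Pow V. card S) = (\<Sum>S\<in>Pow V. card (V - S))"
    by (rule sum.reindex_bij_witness[where i = "\<lambda>S. V - S" and j = "\<lambda>S. V - S"])
      (auto simp: double_diff)
  then have "2 * (\<Sum>S\<in>Pow V. card S) = (\<Sum>S\<in>Pow V. card S + card (V - S))"
    by (simp add: sum.distrib)
  also have "\<dots> = (\<Sum>S\<in>Pow V. card V)"
    using assms by (intro sum.cong) (auto simp: card_Diff_subset finite_subset card_mono)
  finally show ?thesis by simp
qed

text \<open>Double counting of the pairs \<open>(v, S)\<close> with \<open>v \<in> S\<close> and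
  \<open>S \<in> F\<close>. It reduces a bound on the total size to a bound on the number of members
  through each single point.\<close>

lemma sum_card_eq_sum_degree:
  assumes "finite V" "F \<subseteq> Pow V"
  shows "(\<Sum>S\<in>F. card S) = (\<Sum>v\<in>V. card {S \<in> F. v \<in> S})"
proof -
  have fin: "finite F" using assms(1,2) finite_subset by auto
  have "(\<Sum>S\<in>F. card S) = (\<Sum>S\<in>F. \<Sum>v\<in>V. if v \<in> S then 1 else 0)"
    using assms by (intro sum.cong) (auto simp: sum.If_cases Int_absorb1)
  also have "\<dots> = (\<Sum>v\<in>V. \<Sum>S\<in>F. if v \<in> S then 1 else 0)"
    by (rule sum.swap)
  also have "\<dots> = (\<Sum>v\<in>V. card {S \<in> F. v \<in> S})"
    using fin by (intro sum.cong) (auto simp: sum.If_cases Int_def)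
  finally show ?thesis .
qed

lemma image_remove_subset:
  assumes "\<forall>S\<in>F. \<forall>T\<subseteq>S. T \<in> F"
  shows "(\<lambda>S. S - {v}) ` {S \<in> F. v \<in> S} \<subseteq> {S \<in> F. v \<notin> S}"
  using assms by blast

lemma card_image_remove: "card ((\<lambda>S. S - {v}) ` {S \<in> F. v \<in> S}) = card {S \<in> F. v \<in> S}"
  by (rule card_image) (auto simp: inj_on_def)

lemma card_split_mem:
  assumes "finite F"
  shows "card F = card {S \<in> F. v \<in> S} + card {S \<in> F. v \<notin> S}"
proof -
  have "{S \<in> F. v \<in> S} \<union> {S \<in> F. v \<notin> S} = F" by blast
  then show ?thesis
    using assms card_Un_disjoint[of "{S \<in> F. v \<in> S}" "{S \<in> F. v \<notin> S}"] by auto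
qed

lemma double_degree_le:
  assumes "finite F" and down: "\<forall>S\<in>F. \<forall>T\<subseteq>S. T \<in> F"
  shows "2 * card {S \<in> F. v \<in> S} \<le> card F"
proof -
  have "card {S \<in> F. v \<in> S} \<le> card {S \<in> F. v \<notin> S}"
    using card_mono[OF _ image_remove_subset[OF down, of v]] card_image_remove[of v F] assms(1)
    by simp
  then show ?thesis using card_split_mem[OF assms(1), of v] by simp
qed

text \<open>Only \<open>insert v T\<close> could be mapped to \<open>T\<close> by the removal of
  \<open>v\<close>, and it is not in \<open>F\<close>. So the injection misses \<open>T\<close>,
  which avoids \<open>v\<close> since otherwise \<open>insert v T = T\<close>.\<close>

lemma double_degree_less:
  assumes "finite F" and down: "\<forall>S\<in>F. \<forall>T\<subseteq>S. T \<in> F"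
    and "T \<in> F" "insert v T \<notin> F"
  shows "2 * card {S \<in> F. v \<in> S} < card F"
proof -
  have "v \<notin> T" using assms by (metis insert_absorb)
  moreover have "T \<notin> (\<lambda>S. S - {v}) ` {S \<in> F. v \<in> S}"
    using assms(4) by (auto simp: insert_absorb)
  ultimately have "(\<lambda>S. S - {v}) ` {S \<in> F. v \<in> S} \<subset> {S \<in> F. v \<notin> S}"
    using image_remove_subset[OF down, of v] assms(3) by blast
  from psubset_card_mono[OF _ this] have "card {S \<in> F. v \<in> S} < card {S \<in> F. v \<notin> S}"
    using assms(1) unfolding card_image_remove by simp
  then show ?thesis using card_split_mem[OF assms(1), of v] by simp
qed

lemma double_sum_card_less:
  assumes "finite V" "F \<subseteq> Pow V" and down: "\<forall>S\<in>F. \<forall>T\<subseteq>S. T \<in> F"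
    and "v \<in> V" "T \<in> F" "insert v T \<notin> F"
  shows "2 * (\<Sum>S\<in>F. card S) < card V * card F"
proof -
  have fin: "finite F" using assms(1,2) finite_subset by auto
  have "(\<Sum>v\<in>V. 2 * card {S \<in> F. v \<in> S}) < (\<Sum>v\<in>V. card F)"
    using double_degree_less[OF fin down assms(5,6)] double_degree_le[OF fin down] assms(1,4)
    by (intro sum_strict_mono_ex1) auto
  then show ?thesis
    using sum_card_eq_sum_degree[OF assms(1,2)] by (simp add: sum_distrib_left)
qed

text \<open>Splits \<open>F\<close> by sizes 0, 1 and at least 2. The first two classes are
  determined by \<open>V\<close> alone, so only the third one distinguishes families on the same
  ground set.\<close>

lemma singletons_decomp:
  fixes V :: "'a set"
  assumes "finite V" "F \<subseteq> Pow V" "{} \<in> F" "\<And>v. v \<in> V \<Longrightarrow> {v} \<in> F"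
  shows "card F = 1 + card V + card {S \<in> F. 2 \<le> card S}"
    and "(\<Sum>S\<in>F. card S) = card V + (\<Sum>S | S \<in> F \<and> 2 \<le> card S. card S)"
proof -
  let ?Q = "(\<lambda>v. {v}) ` V" and ?R = "{S \<in> F. 2 \<le> card S}"
  have fin: "finite F" using assms(1,2) finite_subset by auto
  have "S = {} \<or> S \<in> ?Q \<or> S \<in> ?R" if "S \<in> F" for S
  proof -
    have S: "S \<subseteq> V" "finite S"
      using that assms(1,2) finite_subset[of S V] by blast+
    consider "card S = 0" | "card S = 1" | "2 \<le> card S" by linarith
    then show ?thesis
    proof cases
      case 2
      then obtain v where "S = {v}" by (rule card_1_singletonE)
      then show ?thesis using S by simp
    qed (use S that in auto)
  qed
  then have F: "F = insert {} (?Q \<union> ?R)" using assms(3,4) by blast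
  have disj: "?Q \<inter> ?R = {}" "{} \<notin> ?Q \<union> ?R" by auto
  have inj: "inj_on (\<lambda>v. {v}) V" by (rule inj_onI) simp
  have fins: "finite ?Q" "finite ?R" using fin assms(1) by auto
  have "card F = 1 + card (?Q \<union> ?R)"
    using card_insert_disjoint[OF finite_UnI[OF fins] disj(2)] arg_cong[OF F, of card] by simp
  then show "card F = 1 + card V + card ?R"
    using card_Un_disjoint[OF fins disj(1)] card_image[OF inj] by simp
  have "sum card F = sum card (?Q \<union> ?R)"
    using sum.insert[OF finite_UnI[OF fins] disj(2), of card] arg_cong[OF F, of "sum card"] by simp
  then show "sum card F = card V + sum card ?R"
    using sum.union_disjoint[OF fins disj(1), of card] sum.reindex[OF inj, of card] by simp
qed

lemma independent_set_mono: "independent_set G S \<Longrightarrow> T \<subseteq> S \<Longrightarrow> independent_set G T"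
  unfolding independent_set_def by (auto intro: pairwise_subset)

lemma independent_set_empty [simp]: "independent_set G {}"
  by (simp add: independent_set_def)

lemma independent_set_singleton [simp]: "independent_set G {v} \<longleftrightarrow> v \<in> verts G"
  by (simp add: independent_set_def)

text \<open>Independence forbids arcs in both directions; symmetry of the arcs makes one direction
  enough.\<close>

lemma independent_set_doubleton:
  assumes "graph G" "u \<noteq> v"
  shows "independent_set G {u, v} \<longleftrightarrow> u \<in> verts G \<and> v \<in> verts G \<and> \<not> u \<rightarrow>\<^bsub>G\<^esub> v"
proof -
  interpret graph G by fact
  show ?thesis
    using assms(2) arcs_ends_symmetric[OF sym_arcs]
    by (auto simp: independent_set_def pairwise_def)
qed

context graph
begin

lemma independent_sets_subset: "{S. independent_set G S} \<subseteq> Pow (verts G)"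
  by (auto simp: independent_set_def)

lemma finite_independent_sets [simp]: "finite {S. independent_set G S}"
  by (rule finite_subset[OF independent_sets_subset]) simp

lemma num_indep_pos: "0 < num_indep G"
  by (auto simp: num_indep_def card_gt_0_iff intro: exI[of _ "{}"])

text \<open>The equations isolate the contribution of the sets of size at least 2, which is zero for
  complete graphs and positive for all others.\<close>

lemma num_indep_eq:
  "num_indep G = 1 + card (verts G) + card {S. independent_set G S \<and> 2 \<le> card S}"
  and total_indep_eq:
  "total_indep G = card (verts G) + (\<Sum>S | independent_set G S \<and> 2 \<le> card S. card S)"
  using singletons_decomp[OF finite_verts independent_sets_subset]
  by (simp_all add: num_indep_def total_indep_def)

lemma avi_complete:
  assumes "complete_digraph n G"
  shows "avi G = real n / (real n + 1)"
proof -
  have "\<not> 2 \<le> card S" if S: "independent_set G S" for S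
  proof
    assume "2 \<le> card S"
    \<comment> \<open>An infinite set has \<open>card\<close> 0, so \<open>2 \<le> card S\<close>
      also gives finiteness.\<close>
    then obtain u v where "u \<in> S" "v \<in> S" "u \<noteq> v"
      using card_le_Suc0_iff_eq[of S] card.infinite[of S] by fastforce
    moreover from this have "u \<rightarrow>\<^bsub>G\<^esub> v"
      using assms S by (auto simp: complete_digraph_def independent_set_def)
    ultimately show False using S by (auto simp: independent_set_def pairwise_def)
  qed
  then have "{S. independent_set G S \<and> 2 \<le> card S} = {}" by blast
  moreover have "card (verts G) = n" using assms by (simp add: complete_digraph_def)
  ultimately have "num_indep G = 1 + n" "total_indep G = n"
    unfolding num_indep_eq total_indep_eq by simp_all
  then show ?thesis by (simp add: avi_def add.commute)
qed

lemma avi_edgeless: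
  assumes "edgeless_digraph n G"
  shows "avi G = real n / 2"
proof -
  have "{S. independent_set G S} = Pow (verts G)"
    using assms by (auto simp: edgeless_digraph_def independent_set_def pairwise_def)
  then have "2 * total_indep G = n * num_indep G"
    using double_sum_card_Pow[OF finite_verts] assms
    by (simp add: total_indep_def num_indep_def edgeless_digraph_def)
  then have "real (2 * total_indep G) = real (n * num_indep G)"
    by (simp only:)
  then show ?thesis using num_indep_pos by (simp add: avi_def field_simps)
qed

lemma avi_greater:
  assumes "\<not> complete_digraph (card (verts G)) G"
  shows "real (card (verts G)) / (real (card (verts G)) + 1) < avi G"
proof -
  let ?n = "card (verts G)" and ?B = "{S. independent_set G S \<and> 2 \<le> card S}"
  have finB: "finite ?B" by (rule finite_subset[OF _ finite_independent_sets]) auto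
  obtain u v where uv: "u \<in> verts G" "v \<in> verts G" "u \<noteq> v" "\<not> u \<rightarrow>\<^bsub>G\<^esub> v"
  proof -
    \<comment> \<open>This inclusion holds in every graph, so a graph that is not complete must
      violate the reverse one, which yields a non-adjacent pair.\<close>
    have "arcs_ends G \<subseteq> {(u, v). (u, v) \<in> verts G \<times> verts G \<and> u \<noteq> v}"
      using adj_not_same adj_in_verts by blast
    then show ?thesis using assms graph_axioms that unfolding complete_digraph_def by blast
  qed
  then have "{u, v} \<in> ?B" using independent_set_doubleton[OF graph_axioms, of u v] by auto
  then have "0 < card ?B" using finB card_gt_0_iff by blast
  \<comment> \<open>With b = \<open>card ?B\<close>, the right side exceeds the left by (n + 2) b >
    0. The factor n + 2 b bounds \<open>total_indep G\<close> from below, as each member of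
    \<open>?B\<close> contributes at least 2.\<close>
  then have "?n * num_indep G < (?n + 1) * (?n + 2 * card ?B)"
    unfolding num_indep_eq by (simp add: algebra_simps)
  moreover have "2 * card ?B \<le> (\<Sum>S\<in>?B. card S)"
    using sum_bounded_below[of ?B 2 card] by (simp add: mult.commute)
  then have "(?n + 1) * (?n + 2 * card ?B) \<le> (?n + 1) * total_indep G"
    unfolding total_indep_eq by (intro mult_left_mono) auto
  ultimately have "?n * num_indep G < (?n + 1) * total_indep G"
    by (rule less_le_trans)
  then have "real (?n * num_indep G) < real ((?n + 1) * total_indep G)"
    by (simp only: of_nat_less_iff)
  then show ?thesis using num_indep_pos by (simp add: avi_def field_simps)
qed

lemma avi_less:
  assumes "\<not> edgeless_digraph (card (verts G)) G"
  shows "avi G < real (card (verts G)) / 2"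
proof -
  obtain u v where uv: "u \<rightarrow>\<^bsub>G\<^esub> v"
    using assms graph_axioms by (auto simp: edgeless_digraph_def)
  then have "v \<noteq> u" "u \<in> verts G" "v \<in> verts G" using adj_not_same adj_in_verts by blast+
  \<comment> \<open>The strict point is \<open>v\<close> with witness \<open>{u}\<close>: this set
    is independent, but \<open>{v, u}\<close> is not.\<close>
  then have "2 * total_indep G < card (verts G) * num_indep G"
    unfolding total_indep_def num_indep_def
    using uv independent_set_doubleton[OF graph_axioms, of v u] arcs_ends_symmetric[OF sym_arcs uv]
    by (intro double_sum_card_less[OF finite_verts independent_sets_subset, where v = v and T = "{u}"])
      (auto intro: independent_set_mono)
  then have "real (2 * total_indep G) < real (card (verts G) * num_indep G)"
    by (simp only: of_nat_less_iff)
  then show ?thesis using num_indep_pos by (simp add: avi_def field_simps)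
qed

end

theorem theorem3p3:
  fixes n :: nat
    and K :: "('a, 'b) pre_digraph"
    and E :: "('c, 'd) pre_digraph"
  assumes "n \<ge> 1"
    and "complete_digraph n K"
    and "edgeless_digraph n E"
  shows "avi K = real n / (real n + 1) \<and>
    avi E = real n / 2 \<and>
    (\<forall>G :: ('e, 'f) pre_digraph.
      graph G \<longrightarrow> card (verts G) = n \<longrightarrow>
      \<not> edgeless_digraph n G \<longrightarrow> \<not> complete_digraph n G \<longrightarrow>
      real n / (real n + 1) = avi K \<and> avi K < avi G \<and> avi G < avi E \<and> avi E = real n / 2)"
proof -
  have "avi K = real n / (real n + 1)"
    using assms(2) graph.avi_complete by (auto simp: complete_digraph_def)
  moreover have "avi E = real n / 2"
    using assms(3) graph.avi_edgeless by (auto simp: edgeless_digraph_def)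
  \<comment> \<open>The graphs \<open>K\<close>, \<open>E\<close> and \<open>G\<close> may live on
    different types; they are compared only through the two values that depend on \<open>n\<close>
    alone.\<close>
  ultimately show ?thesis using graph.avi_greater graph.avi_less by metis
qed

end
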